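(* Suppose that $S$ and $T$ are strongly Morita equivalent inverse semigroups with $E(S)$ and $E(T)$ directed. Then the congruence lattices $\mathrm{Cong}(S)$ and $\mathrm{Cong}(T)$ are isomorphic.
   Context: An inverse semigroup is a semigroup $S$ such that for each $s\in S$ there is a unique $s^*\in S$ with $ss^*s=s$ and $s^*ss^*=s^*$; $E(S)$ is its set of idempotents, ordered by $e\le f$ iff $ef=e$. $E(S)$ is directed if for all $e,e'\in E(S)$ there is $f\in E(S)$ with $e,e'\le f$. $\mathrm{Cong}(S)$ is the lattice of semigroup congruences on $S$ ordered by inclusion. A Morita context is a 5-tuple $(S,T,X,\langle\ ,\ \rangle,[\ ,\ ])$ where $S,T$ are inverse semigroups, $X$ is a set with a left action of $S$ and a right action of $T$ that commute, and $\langle\ ,\ \rangle\colon X\times X\to S$, $[\ ,\ ]\colon X\times X\to T$ are surjective functions such that for all $x,y,z\in X$, $s\in S$, $t\in T$: (1) $\langle sx,y\rangle=s\langle x,y\rangle$; (2) $\langle y,x\rangle=\langle x,y\rangle^*$; (3) $\langle x,x\rangle x=x$; (4) $[x,yt]=[x,y]t$; (5) $[y,x]=[x,y]^*$; (6) $x[x,x]=x$; (7) $\langle x,y\rangle z=x[y,z]$. $S$ and $T$ are strongly Morita equivalent if such a Morita context exists. *)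

theory Defs
  imports "HOL-Algebra.Complete_Lattice"
begin

section \<open>Inverse semigroups\<close>

record 'a semigrp = "'a partial_object" +
  sg_mult :: "'a \<Rightarrow> 'a \<Rightarrow> 'a" (infixl \<open>\<cdot>\<index>\<close> 70)

locale carrier_semigroup =
  fixes S (structure)
  assumes sg_closed: "\<lbrakk>a \<in> carrier S; b \<in> carrier S\<rbrakk> \<Longrightarrow> a \<cdot> b \<in> carrier S"
    and sg_assoc: "\<lbrakk>a \<in> carrier S; b \<in> carrier S; c \<in> carrier S\<rbrakk>
      \<Longrightarrow> (a \<cdot> b) \<cdot> c = a \<cdot> (b \<cdot> c)"

locale inverse_semigroup = carrier_semigroup +
  assumes unique_inverse:
    "s \<in> carrier S \<Longrightarrow> \<exists>!t. t \<in> carrier S \<and> s \<cdot> t \<cdot> s = s \<and> t \<cdot> s \<cdot> t = t"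

definition sg_inv :: "('a, 'm) semigrp_scheme \<Rightarrow> 'a \<Rightarrow> 'a" where
  "sg_inv S s = (THE t. t \<in> carrier S \<and> s \<cdot>\<^bsub>S\<^esub> t \<cdot>\<^bsub>S\<^esub> s = s \<and> t \<cdot>\<^bsub>S\<^esub> s \<cdot>\<^bsub>S\<^esub> t = t)"

definition idempotents :: "('a, 'm) semigrp_scheme \<Rightarrow> 'a set" where
  "idempotents S = {e \<in> carrier S. e \<cdot>\<^bsub>S\<^esub> e = e}"

definition idem_le :: "('a, 'm) semigrp_scheme \<Rightarrow> 'a \<Rightarrow> 'a \<Rightarrow> bool" where
  "idem_le S e f \<longleftrightarrow> e \<cdot>\<^bsub>S\<^esub> f = e"

definition directed_idempotents :: "('a, 'm) semigrp_scheme \<Rightarrow> bool" where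
  "directed_idempotents S \<longleftrightarrow>
    (\<forall>e\<in>idempotents S. \<forall>e'\<in>idempotents S. \<exists>f\<in>idempotents S. idem_le S e f \<and> idem_le S e' f)"


section \<open>The congruence lattice\<close>

definition congruences :: "('a, 'm) semigrp_scheme \<Rightarrow> ('a \<times> 'a) set set" where
  "congruences S = {r. equiv (carrier S) r \<and>
    (\<forall>a b c d. (a, b) \<in> r \<longrightarrow> (c, d) \<in> r \<longrightarrow> (a \<cdot>\<^bsub>S\<^esub> c, b \<cdot>\<^bsub>S\<^esub> d) \<in> r)}"

definition cong_lattice :: "('a, 'm) semigrp_scheme \<Rightarrow> ('a \<times> 'a) set gorder" where
  "cong_lattice S = \<lparr>carrier = congruences S, eq = (=), le = (\<subseteq>)\<rparr>"

definition lattices_isomorphic ::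
    "('a, 'c) gorder_scheme \<Rightarrow> ('b, 'd) gorder_scheme \<Rightarrow> bool" where
  "lattices_isomorphic L M \<longleftrightarrow>
    (\<exists>f. bij_betw f (carrier L) (carrier M) \<and> join_pres L M f \<and> meet_pres L M f)"

lemma (in carrier_semigroup) cong_lattice_complete: "complete_lattice (cong_lattice S)"
proof -
  interpret partial_order "cong_lattice S"
    by unfold_locales (auto simp: cong_lattice_def)
  show ?thesis
  proof (rule complete_lattice_criterion1)
    have "carrier S \<times> carrier S \<in> congruences S"
      by (auto simp: congruences_def sg_closed intro!: equivI refl_onI symI transI)
    then show "\<exists>g. greatest (cong_lattice S) g (carrier (cong_lattice S))"
      unfolding greatest_def
      by (intro exI[of _ "carrier S \<times> carrier S"])
        (auto simp: cong_lattice_def congruences_def equiv_def)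
  next
    fix A assume A: "A \<subseteq> carrier (cong_lattice S)" "A \<noteq> {}"
    have r: "equiv (carrier S) r"
      and m: "\<And>a b c d. (a, b) \<in> r \<Longrightarrow> (c, d) \<in> r \<Longrightarrow> (a \<cdot> c, b \<cdot> d) \<in> r"
      if "r \<in> A" for r
      using A(1) that by (auto simp: cong_lattice_def congruences_def)
    have "equiv (carrier S) (\<Inter>A)"
    proof (rule equivI)
      show "\<Inter>A \<subseteq> carrier S \<times> carrier S"
        using A(2) r by (fastforce simp: equiv_def)
      show "refl_on (carrier S) (\<Inter>A)"
        using r by (auto intro!: refl_onI dest: equivE refl_onD simp: equiv_def)
      show "sym (\<Inter>A)"
        using r by (auto intro!: symI dest: symD simp: equiv_def)
      show "trans (\<Inter>A)"
        using r by (intro transI InterI) (metis InterD equivE transE)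
    qed
    then have "\<Inter>A \<in> congruences S"
      using m by (simp add: congruences_def)
    then show "\<exists>i. greatest (cong_lattice S) i (Lower (cong_lattice S) A)"
      unfolding greatest_def Lower_def
      by (intro exI[of _ "\<Inter>A"]) (use A in \<open>auto simp: cong_lattice_def\<close>)
  qed
qed


section \<open>Strong Morita equivalence\<close>

locale morita_context = S: inverse_semigroup S + T: inverse_semigroup T
  for S :: "('a, 'm) semigrp_scheme" (structure)
    and T :: "('b, 'n) semigrp_scheme" (structure) +
  fixes X :: "'x set"
    and lact :: "'a \<Rightarrow> 'x \<Rightarrow> 'x" (infixr \<open>\<rhd>\<close> 75)
    and ract :: "'x \<Rightarrow> 'b \<Rightarrow> 'x" (infixl \<open>\<lhd>\<close> 75)
    and ang :: "'x \<Rightarrow> 'x \<Rightarrow> 'a"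
    and sqb :: "'x \<Rightarrow> 'x \<Rightarrow> 'b"
  assumes lact_closed: "\<lbrakk>s \<in> carrier S; x \<in> X\<rbrakk> \<Longrightarrow> s \<rhd> x \<in> X"
    and lact_mult: "\<lbrakk>s \<in> carrier S; s' \<in> carrier S; x \<in> X\<rbrakk> \<Longrightarrow> (s \<cdot>\<^bsub>S\<^esub> s') \<rhd> x = s \<rhd> (s' \<rhd> x)"
    and ract_closed: "\<lbrakk>x \<in> X; t \<in> carrier T\<rbrakk> \<Longrightarrow> x \<lhd> t \<in> X"
    and ract_mult: "\<lbrakk>x \<in> X; t \<in> carrier T; t' \<in> carrier T\<rbrakk> \<Longrightarrow> x \<lhd> (t \<cdot>\<^bsub>T\<^esub> t') = (x \<lhd> t) \<lhd> t'"
    and act_commute: "\<lbrakk>s \<in> carrier S; x \<in> X; t \<in> carrier T\<rbrakk> \<Longrightarrow> (s \<rhd> x) \<lhd> t = s \<rhd> (x \<lhd> t)"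
    and ang_onto: "(\<lambda>(x, y). ang x y) ` (X \<times> X) = carrier S"
    and sqb_onto: "(\<lambda>(x, y). sqb x y) ` (X \<times> X) = carrier T"
    and ang_lact: "\<lbrakk>s \<in> carrier S; x \<in> X; y \<in> X\<rbrakk> \<Longrightarrow> ang (s \<rhd> x) y = s \<cdot>\<^bsub>S\<^esub> ang x y"
    and ang_inv: "\<lbrakk>x \<in> X; y \<in> X\<rbrakk> \<Longrightarrow> ang y x = sg_inv S (ang x y)"
    and ang_self: "x \<in> X \<Longrightarrow> ang x x \<rhd> x = x"
    and sqb_ract: "\<lbrakk>x \<in> X; y \<in> X; t \<in> carrier T\<rbrakk> \<Longrightarrow> sqb x (y \<lhd> t) = sqb x y \<cdot>\<^bsub>T\<^esub> t"
    and sqb_inv: "\<lbrakk>x \<in> X; y \<in> X\<rbrakk> \<Longrightarrow> sqb y x = sg_inv T (sqb x y)"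
    and sqb_self: "x \<in> X \<Longrightarrow> x \<lhd> sqb x x = x"
    and ang_sqb: "\<lbrakk>x \<in> X; y \<in> X; z \<in> X\<rbrakk> \<Longrightarrow> ang x y \<rhd> z = x \<lhd> sqb y z"

text \<open>HOL cannot quantify over types inside a formula, so the type in which the set \<open>X\<close> lives
  is an explicit parameter; leaving \<open>'x\<close> free in a hypothesis covers every \<open>X\<close>.\<close>

definition strongly_morita_equivalent ::
    "'x itself \<Rightarrow> ('a, 'm) semigrp_scheme \<Rightarrow> ('b, 'n) semigrp_scheme \<Rightarrow> bool" where
  "strongly_morita_equivalent (_ :: 'x itself) S T \<longleftrightarrow>
    (\<exists>(X :: 'x set) lact ract ang sqb. morita_context S T X lact ract ang sqb)"

end

theory Submission
  imports Defs
begin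

text \<open>A congruence \<open>\<rho>\<close> on \<open>S\<close> is carried to the relation on \<open>T\<close> that identifies \<open>t\<close> and \<open>t'\<close> when
  \<open>\<langle>xt, y\<rangle> \<rho> \<langle>xt', y\<rangle>\<close> for all \<open>x, y \<in> X\<close>; right compatibility of this relation holds because
  \<open>\<langle>xt[u, v], y\<rangle> = \<langle>xt, u\<rangle>\<langle>v, y\<rangle>\<close>. Going to \<open>T\<close> and back identifies \<open>s\<close> and \<open>s'\<close> exactly when
  \<open>\<langle>u, x\<rangle> s \<langle>y, v\<rangle> \<rho> \<langle>u, x\<rangle> s' \<langle>y, v\<rangle>\<close> for all \<open>u, x, y, v \<in> X\<close>, that is, when \<open>asb \<rho> as'b\<close> for all
  \<open>a, b \<in> S\<close>. Directedness supplies one idempotent that is a two-sided identity for both \<open>s\<close> and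
  \<open>s'\<close>, so the result is \<open>\<rho>\<close> again. Both passages preserve inclusion, so they are mutually inverse
  lattice isomorphisms.\<close>

section \<open>Inverse semigroups\<close>

context inverse_semigroup
begin

lemma inv_props:
  assumes "s \<in> carrier S"
  shows sg_inv_closed: "sg_inv S s \<in> carrier S"
    and mult_inv_mult: "s \<cdot> sg_inv S s \<cdot> s = s"
    and inv_mult_inv: "sg_inv S s \<cdot> s \<cdot> sg_inv S s = sg_inv S s"
  using theI'[OF unique_inverse[OF assms]] by (simp_all add: sg_inv_def)

lemma sg_inv_eqI:
  assumes "s \<in> carrier S" "t \<in> carrier S" "s \<cdot> t \<cdot> s = s" "t \<cdot> s \<cdot> t = t"
  shows "sg_inv S s = t"
  using unique_inverse[OF assms(1)] assms inv_props[OF assms(1)] by blast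

lemma sg_inv_inv: "s \<in> carrier S \<Longrightarrow> sg_inv S (sg_inv S s) = s"
  by (rule sg_inv_eqI) (simp_all add: inv_props)

section \<open>Commuting idempotents and the inverse of a product\<close>

lemma idempotent_closed: "e \<in> idempotents S \<Longrightarrow> e \<in> carrier S"
  by (simp add: idempotents_def)

lemma idempotent_idem: "e \<in> idempotents S \<Longrightarrow> e \<cdot> e = e"
  by (simp add: idempotents_def)

lemma mult_inv_idempotent: "s \<in> carrier S \<Longrightarrow> s \<cdot> sg_inv S s \<in> idempotents S"
  using mult_inv_mult[of s]
  by (simp add: idempotents_def sg_closed sg_inv_closed flip: sg_assoc)

lemma inv_mult_idempotent: "s \<in> carrier S \<Longrightarrow> sg_inv S s \<cdot> s \<in> idempotents S"
  using mult_inv_idempotent[of "sg_inv S s"] by (simp add: sg_inv_closed sg_inv_inv)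

lemma sg_inv_idempotent: "e \<in> idempotents S \<Longrightarrow> sg_inv S e = e"
  by (intro sg_inv_eqI) (simp_all add: idempotents_def)

text \<open>Right-nested form of the idempotent law, which still matches once
  \<open>sg_assoc\<close> has moved all brackets to the right.\<close>

lemma idempotent_left_absorb:
  "\<lbrakk>e \<in> idempotents S; a \<in> carrier S\<rbrakk> \<Longrightarrow> e \<cdot> (e \<cdot> a) = e \<cdot> a"
  by (simp add: idempotent_closed idempotent_idem flip: sg_assoc)

text \<open>Let \<open>x\<close> be the inverse of \<open>e \<cdot> f\<close>. Then
  \<open>f \<cdot> (x \<cdot> e)\<close> is another inverse, so it equals \<open>x\<close> by
  uniqueness, and in this form \<open>x\<close> squares to itself. An idempotent is its own inverse,
  hence \<open>e \<cdot> f\<close> is \<open>x\<close>.\<close>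

lemma idempotents_mult:
  assumes e: "e \<in> idempotents S" and f: "f \<in> idempotents S"
  shows "e \<cdot> f \<in> idempotents S"
proof -
  note ef = idempotent_closed[OF e] idempotent_closed[OF f]
  define x where "x = sg_inv S (e \<cdot> f)"
  have x: "x \<in> carrier S" "e \<cdot> (f \<cdot> (x \<cdot> (e \<cdot> f))) = e \<cdot> f" "x \<cdot> (e \<cdot> (f \<cdot> x)) = x"
    using inv_props[of "e \<cdot> f"] ef by (simp_all add: x_def sg_assoc sg_closed)
  \<comment> \<open>\<open>x(3)\<close> with a trailing factor, for use inside longer right-nested
    products.\<close>
  have x3: "x \<cdot> (e \<cdot> (f \<cdot> (x \<cdot> a))) = x \<cdot> a" if "a \<in> carrier S" for a
    using arg_cong[OF x(3), of "\<lambda>u. u \<cdot> a"] ef x(1) that by (simp add: sg_assoc sg_closed)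
  have fxe: "f \<cdot> (x \<cdot> e) = x"
    by (subst (2) x_def, rule sg_inv_eqI[symmetric])
      (use ef x in \<open>simp_all add: sg_assoc sg_closed x3 idempotent_left_absorb[OF e]
        idempotent_left_absorb[OF f]\<close>)
  have "f \<cdot> (x \<cdot> e) \<cdot> (f \<cdot> (x \<cdot> e)) = f \<cdot> (x \<cdot> e)"
    using ef x by (simp add: sg_assoc sg_closed x3)
  then have "x \<cdot> x = x"
    unfolding fxe .
  then have "x \<in> idempotents S"
    using x(1) by (simp add: idempotents_def)
  then have "e \<cdot> f = x"
    using sg_inv_idempotent[of x] sg_inv_inv[of "e \<cdot> f"] ef by (simp add: x_def sg_closed)
  with \<open>x \<in> idempotents S\<close> show ?thesis by simp
qed

text \<open>As both products are idempotent, \<open>f \<cdot> e\<close> is an inverse of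
  \<open>e \<cdot> f\<close>. So is \<open>e \<cdot> f\<close> itself, and inverses are
  unique.\<close>

lemma idempotents_commute:
  assumes e: "e \<in> idempotents S" and f: "f \<in> idempotents S"
  shows "e \<cdot> f = f \<cdot> e"
proof -
  note ef = idempotent_closed[OF e] idempotent_closed[OF f]
  note idem = idempotent_idem[OF idempotents_mult[OF e f]]
    idempotent_idem[OF idempotents_mult[OF f e]]
  have "sg_inv S (e \<cdot> f) = f \<cdot> e"
    by (rule sg_inv_eqI)
      (use ef idem in \<open>simp_all add: sg_assoc sg_closed idempotent_left_absorb[OF e]
        idempotent_left_absorb[OF f]\<close>)
  then show ?thesis
    using sg_inv_idempotent[OF idempotents_mult[OF e f]] by simp
qed

text \<open>The idempotents \<open>?s \<cdot> s\<close> and \<open>t \<cdot> ?t\<close> meet in the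
  middle of each product; commuting them leaves only factors that collapse by the inverse
  laws.\<close>

lemma sg_inv_mult:
  assumes s: "s \<in> carrier S" and t: "t \<in> carrier S"
  shows "sg_inv S (s \<cdot> t) = sg_inv S t \<cdot> sg_inv S s"
proof (rule sg_inv_eqI)
  let ?s = "sg_inv S s" and ?t = "sg_inv S t"
  note cl = s t sg_inv_closed[OF s] sg_inv_closed[OF t]
  have comm: "(?s \<cdot> s) \<cdot> (t \<cdot> ?t) = (t \<cdot> ?t) \<cdot> (?s \<cdot> s)"
    using idempotents_commute inv_mult_idempotent mult_inv_idempotent s t by blast
  have "s \<cdot> t \<cdot> (?t \<cdot> ?s) \<cdot> (s \<cdot> t) = s \<cdot> ((t \<cdot> ?t) \<cdot> (?s \<cdot> s)) \<cdot> t"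
    using cl by (simp add: sg_assoc sg_closed)
  also have "\<dots> = (s \<cdot> ?s \<cdot> s) \<cdot> (t \<cdot> ?t \<cdot> t)"
    unfolding comm[symmetric] using cl by (simp add: sg_assoc sg_closed)
  finally show "s \<cdot> t \<cdot> (?t \<cdot> ?s) \<cdot> (s \<cdot> t) = s \<cdot> t"
    using s t by (simp add: mult_inv_mult)
  have "?t \<cdot> ?s \<cdot> (s \<cdot> t) \<cdot> (?t \<cdot> ?s) = ?t \<cdot> ((?s \<cdot> s) \<cdot> (t \<cdot> ?t)) \<cdot> ?s"
    using cl by (simp add: sg_assoc sg_closed)
  also have "\<dots> = (?t \<cdot> t \<cdot> ?t) \<cdot> (?s \<cdot> s \<cdot> ?s)"
    unfolding comm using cl by (simp add: sg_assoc sg_closed)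
  finally show "?t \<cdot> ?s \<cdot> (s \<cdot> t) \<cdot> (?t \<cdot> ?s) = ?t \<cdot> ?s"
    using s t by (simp add: inv_mult_inv)
qed (use assms in \<open>simp_all add: sg_closed sg_inv_closed\<close>)

section \<open>Directed idempotents and common identities of finite sets\<close>

lemma directed_upper_bound:
  assumes "directed_idempotents S" "finite F" "F \<subseteq> idempotents S" "F \<noteq> {}"
  shows "\<exists>f\<in>idempotents S. \<forall>e\<in>F. idem_le S e f"
  using assms(2,4,3)
\<comment> \<open>The base case is a single idempotent: an empty carrier satisfies
  \<open>directed_idempotents\<close> but offers no bound for the empty set.\<close>
proof (induction F rule: finite_ne_induct)
  case (singleton e)
  then show ?case
    by (auto simp: idem_le_def idempotents_def)
next
  case (insert e F)
  then obtain g where g: "g \<in> idempotents S" "\<forall>e'\<in>F. idem_le S e' g"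
    by auto
  then obtain f where f: "f \<in> idempotents S" "idem_le S e f" "idem_le S g f"
    using assms(1) insert.prems unfolding directed_idempotents_def by blast
  have "idem_le S e' f" if "e' \<in> F" for e'
  proof -
    have "e' \<in> carrier S" "g \<in> carrier S" "f \<in> carrier S"
      using that g f insert.prems idempotent_closed by auto
    moreover have "e' \<cdot> g = e'" "g \<cdot> f = g"
      using that g f by (auto simp: idem_le_def)
    ultimately show ?thesis
      using sg_assoc[of e' g f] by (simp add: idem_le_def)
  qed
  then show ?case
    using f by auto
qed

text \<open>An idempotent above \<open>s \<cdot> sg_inv S s\<close> fixes \<open>s\<close> from the
  left, one above \<open>sg_inv S s \<cdot> s\<close> fixes it from the right. Directedness bounds
  all these finitely many idempotents at once.\<close>

lemma common_local_identity:
  assumes dir: "directed_idempotents S" and A: "finite A" "A \<subseteq> carrier S" "A \<noteq> {}"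
  obtains f where "f \<in> idempotents S" "\<And>s. s \<in> A \<Longrightarrow> f \<cdot> s = s" "\<And>s. s \<in> A \<Longrightarrow> s \<cdot> f = s"
proof -
  let ?F = "(\<lambda>s. s \<cdot> sg_inv S s) ` A \<union> (\<lambda>s. sg_inv S s \<cdot> s) ` A"
  have F: "?F \<subseteq> idempotents S"
    using A(2) mult_inv_idempotent inv_mult_idempotent by blast
  obtain f where f: "f \<in> idempotents S" "\<forall>e\<in>?F. e \<cdot> f = e"
    using directed_upper_bound[OF dir _ F] A unfolding idem_le_def by auto
  show thesis
  proof (rule that[OF f(1)])
    fix s assume "s \<in> A"
    then have s: "s \<in> carrier S" and e: "s \<cdot> sg_inv S s \<cdot> f = s \<cdot> sg_inv S s"
      "sg_inv S s \<cdot> s \<cdot> f = sg_inv S s \<cdot> s"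
      using A(2) f(2) by auto
    note cl = s sg_inv_closed[OF s] idempotent_closed[OF f(1)]
    \<comment> \<open>\<open>idem_le\<close> only speaks of \<open>f\<close> as a right factor;
      commuting idempotents brings it to the left.\<close>
    have "f \<cdot> (s \<cdot> sg_inv S s) = s \<cdot> sg_inv S s"
      using e(1) idempotents_commute[OF f(1) mult_inv_idempotent[OF s]] by simp
    then show "f \<cdot> s = s"
      using cl mult_inv_mult[OF s] sg_assoc[of f "s \<cdot> sg_inv S s" s] by (simp add: sg_closed)
    show "s \<cdot> f = s"
      using cl e(2) mult_inv_mult[OF s] sg_assoc[of s "sg_inv S s \<cdot> s" f]
      by (simp add: sg_closed sg_assoc)
  qed
qed

end

section \<open>Congruences\<close>

lemma congruencesD:
  assumes "r \<in> congruences S"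
  shows congruence_field: "\<And>a b. (a, b) \<in> r \<Longrightarrow> a \<in> carrier S \<and> b \<in> carrier S"
    and congruence_refl: "\<And>a. a \<in> carrier S \<Longrightarrow> (a, a) \<in> r"
    and congruence_sym: "\<And>a b. (a, b) \<in> r \<Longrightarrow> (b, a) \<in> r"
    and congruence_trans: "\<And>a b c. (a, b) \<in> r \<Longrightarrow> (b, c) \<in> r \<Longrightarrow> (a, c) \<in> r"
    and congruence_mult: "\<And>a b c d. (a, b) \<in> r \<Longrightarrow> (c, d) \<in> r \<Longrightarrow> (a \<cdot>\<^bsub>S\<^esub> c, b \<cdot>\<^bsub>S\<^esub> d) \<in> r"
  using assms
  by (auto simp: congruences_def equiv_def dest: refl_onD symD transD)

text \<open>One-sided compatibility suffices: \<open>a \<cdot> c\<close> is related to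
  \<open>b \<cdot> c\<close>, and that to \<open>b \<cdot> d\<close>.\<close>

lemma congruencesI:
  assumes "\<And>a b. (a, b) \<in> r \<Longrightarrow> a \<in> carrier S \<and> b \<in> carrier S"
    and "\<And>a. a \<in> carrier S \<Longrightarrow> (a, a) \<in> r"
    and "\<And>a b. (a, b) \<in> r \<Longrightarrow> (b, a) \<in> r"
    and trans: "\<And>a b c. (a, b) \<in> r \<Longrightarrow> (b, c) \<in> r \<Longrightarrow> (a, c) \<in> r"
    and left: "\<And>a b c. (a, b) \<in> r \<Longrightarrow> c \<in> carrier S \<Longrightarrow> (c \<cdot>\<^bsub>S\<^esub> a, c \<cdot>\<^bsub>S\<^esub> b) \<in> r"
    and right: "\<And>a b c. (a, b) \<in> r \<Longrightarrow> c \<in> carrier S \<Longrightarrow> (a \<cdot>\<^bsub>S\<^esub> c, b \<cdot>\<^bsub>S\<^esub> c) \<in> r"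
  shows "r \<in> congruences S"
proof -
  have "equiv (carrier S) r"
    by (intro equivI refl_onI symI transI) (auto dest: assms(1) intro: assms(2,3) trans)
  moreover have "(a \<cdot>\<^bsub>S\<^esub> c, b \<cdot>\<^bsub>S\<^esub> d) \<in> r" if "(a, b) \<in> r" "(c, d) \<in> r" for a b c d
    using that assms(1) by (blast intro: trans left right)
  ultimately show ?thesis
    by (simp add: congruences_def)
qed

section \<open>Order isomorphisms of lattices\<close>

lemma lattices_isomorphicI:
  assumes L: "lattice L" and M: "lattice M"
    and f: "f \<in> carrier L \<rightarrow> carrier M" and g: "g \<in> carrier M \<rightarrow> carrier L"
    and gf: "\<And>x. x \<in> carrier L \<Longrightarrow> g (f x) = x"
    and fg: "\<And>y. y \<in> carrier M \<Longrightarrow> f (g y) = y"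
    and f_mono: "\<And>x y. \<lbrakk>x \<in> carrier L; y \<in> carrier L; x \<sqsubseteq>\<^bsub>L\<^esub> y\<rbrakk> \<Longrightarrow> f x \<sqsubseteq>\<^bsub>M\<^esub> f y"
    and g_mono: "\<And>x y. \<lbrakk>x \<in> carrier M; y \<in> carrier M; x \<sqsubseteq>\<^bsub>M\<^esub> y\<rbrakk> \<Longrightarrow> g x \<sqsubseteq>\<^bsub>L\<^esub> g y"
  shows "lattices_isomorphic L M"
proof -
  interpret L: lattice L by (rule L)
  interpret M: lattice M by (rule M)
  note cl = funcset_mem[OF f] funcset_mem[OF g]
  \<comment> \<open>Monotone and mutually inverse, \<open>f\<close> and \<open>g\<close> are adjoint
    in both orders, so bounds in one lattice can be tested in the other.\<close>
  have le: "f x \<sqsubseteq>\<^bsub>M\<^esub> z \<longleftrightarrow> x \<sqsubseteq>\<^bsub>L\<^esub> g z" "z \<sqsubseteq>\<^bsub>M\<^esub> f x \<longleftrightarrow> g z \<sqsubseteq>\<^bsub>L\<^esub> x"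
    if "x \<in> carrier L" "z \<in> carrier M" for x z
    using f_mono[OF that(1) cl(2)[OF that(2)]] g_mono[OF cl(1)[OF that(1)] that(2)]
      f_mono[OF cl(2)[OF that(2)] that(1)] g_mono[OF that(2) cl(1)[OF that(1)]]
    unfolding gf[OF that(1)] fg[OF that(2)] by blast+
  have "f (x \<squnion>\<^bsub>L\<^esub> y) = f x \<squnion>\<^bsub>M\<^esub> f y" if x: "x \<in> carrier L" and y: "y \<in> carrier L" for x y
  proof (rule M.le_antisym)
    have "x \<sqsubseteq>\<^bsub>L\<^esub> g (f x \<squnion>\<^bsub>M\<^esub> f y)" "y \<sqsubseteq>\<^bsub>L\<^esub> g (f x \<squnion>\<^bsub>M\<^esub> f y)"
      by (subst le(1)[symmetric]; use x y cl(1) in \<open>simp add: M.join_left M.join_right\<close>)+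
    then show "f (x \<squnion>\<^bsub>L\<^esub> y) \<sqsubseteq>\<^bsub>M\<^esub> f x \<squnion>\<^bsub>M\<^esub> f y"
      using x y cl by (simp add: le L.join_le)
    show "f x \<squnion>\<^bsub>M\<^esub> f y \<sqsubseteq>\<^bsub>M\<^esub> f (x \<squnion>\<^bsub>L\<^esub> y)"
      using x y cl by (intro M.join_le f_mono) (auto intro: L.join_left L.join_right)
  qed (use x y cl in auto)
  moreover have "f (x \<sqinter>\<^bsub>L\<^esub> y) = f x \<sqinter>\<^bsub>M\<^esub> f y" if x: "x \<in> carrier L" and y: "y \<in> carrier L" for x y
  proof (rule M.le_antisym)
    have "g (f x \<sqinter>\<^bsub>M\<^esub> f y) \<sqsubseteq>\<^bsub>L\<^esub> x" "g (f x \<sqinter>\<^bsub>M\<^esub> f y) \<sqsubseteq>\<^bsub>L\<^esub> y"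
      by (subst le(2)[symmetric]; use x y cl(1) in \<open>simp add: M.meet_left M.meet_right\<close>)+
    then show "f x \<sqinter>\<^bsub>M\<^esub> f y \<sqsubseteq>\<^bsub>M\<^esub> f (x \<sqinter>\<^bsub>L\<^esub> y)"
      using x y cl by (simp add: le L.meet_le)
    show "f (x \<sqinter>\<^bsub>L\<^esub> y) \<sqsubseteq>\<^bsub>M\<^esub> f x \<sqinter>\<^bsub>M\<^esub> f y"
      using x y cl by (intro M.meet_le f_mono) (auto intro: L.meet_left L.meet_right)
  qed (use x y cl in auto)
  moreover have "bij_betw f (carrier L) (carrier M)"
    by (rule bij_betwI[OF f g gf fg])
  ultimately show ?thesis
    using L M unfolding lattices_isomorphic_def join_pres_def meet_pres_def by blast
qed

section \<open>Transporting congruences along a Morita context\<close>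

context morita_context
begin

lemma ang_closed: "\<lbrakk>x \<in> X; y \<in> X\<rbrakk> \<Longrightarrow> ang x y \<in> carrier S"
  by (auto simp flip: ang_onto)

lemma sqb_closed: "\<lbrakk>x \<in> X; y \<in> X\<rbrakk> \<Longrightarrow> sqb x y \<in> carrier T"
  by (auto simp flip: sqb_onto)

lemma sqb_cases:
  assumes "t \<in> carrier T"
  obtains x y where "x \<in> X" "y \<in> X" "t = sqb x y"
  using assms by (auto simp flip: sqb_onto)

text \<open>Inverting a bracket exchanges its arguments, so \<open>ang_lact\<close> reaches the
  second argument at the price of an inverse on \<open>s\<close>.\<close>

lemma ang_lact_right:
  "\<lbrakk>s \<in> carrier S; x \<in> X; y \<in> X\<rbrakk> \<Longrightarrow> ang x (s \<rhd> y) = ang x y \<cdot>\<^bsub>S\<^esub> sg_inv S s"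
  by (simp add: ang_inv[of "s \<rhd> y" x] ang_inv[of y x] lact_closed ang_lact S.sg_inv_mult
      ang_closed)

lemma sqb_ract_left:
  "\<lbrakk>t \<in> carrier T; x \<in> X; y \<in> X\<rbrakk> \<Longrightarrow> sqb (x \<lhd> t) y = sg_inv T t \<cdot>\<^bsub>T\<^esub> sqb x y"
  by (simp add: sqb_inv[of y "x \<lhd> t"] sqb_inv[of y x] ract_closed sqb_ract T.sg_inv_mult
      sqb_closed)

text \<open>By \<open>ang_sqb\<close>, \<open>x \<lhd> sqb u v\<close> is
  \<open>ang x u \<rhd> v\<close>, and \<open>ang_lact\<close> takes the left factor out.\<close>

lemma ang_ract_sqb:
  "\<lbrakk>x \<in> X; u \<in> X; v \<in> X; y \<in> X\<rbrakk> \<Longrightarrow> ang (x \<lhd> sqb u v) y = ang x u \<cdot>\<^bsub>S\<^esub> ang v y"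
  by (simp add: ang_sqb[symmetric] ang_lact ang_closed)

text \<open>Inversion reverses products, so acting through inverses exchanges left and right
  actions. This symmetry gives the passage from \<open>T\<close> to \<open>S\<close> all properties
  of the one from \<open>S\<close> to \<open>T\<close>.\<close>

lemma morita_context_swap:
  "morita_context T S X (\<lambda>t x. x \<lhd> sg_inv T t) (\<lambda>x s. sg_inv S s \<rhd> x) sqb ang"
proof unfold_locales
  fix x y z assume "x \<in> X" "y \<in> X" "z \<in> X"
  \<comment> \<open>With the inverses absorbed by exchanging arguments, this is
    \<open>ang_sqb\<close> for \<open>z\<close>, \<open>y\<close>, \<open>x\<close>.\<close>
  then show "z \<lhd> sg_inv T (sqb x y) = sg_inv S (ang y z) \<rhd> x"
    by (simp add: ang_sqb flip: sqb_inv ang_inv)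
next
  fix x assume "x \<in> X"
  then show "x \<lhd> sg_inv T (sqb x x) = x" "sg_inv S (ang x x) \<rhd> x = x"
    by (simp_all add: sqb_self ang_self flip: sqb_inv ang_inv)
qed (simp_all add: lact_closed ract_closed lact_mult[symmetric] ract_mult[symmetric] act_commute
    S.sg_inv_closed T.sg_inv_closed S.sg_inv_mult T.sg_inv_mult S.sg_inv_inv T.sg_inv_inv
    ang_onto sqb_onto ang_lact_right sqb_ract_left flip: ang_inv sqb_inv)

definition transport :: "('a \<times> 'a) set \<Rightarrow> ('b \<times> 'b) set" where
  "transport r = {(t, t'). t \<in> carrier T \<and> t' \<in> carrier T \<and>
    (\<forall>x\<in>X. \<forall>y\<in>X. (ang (x \<lhd> t) y, ang (x \<lhd> t') y) \<in> r)}"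

lemma transport_mono: "r \<subseteq> r' \<Longrightarrow> transport r \<subseteq> transport r'"
  unfolding transport_def by blast

lemma transport_congruence:
  assumes r: "r \<in> congruences S"
  shows "transport r \<in> congruences T"
proof (rule congruencesI)
  fix t assume "t \<in> carrier T"
  then show "(t, t) \<in> transport r"
    by (simp add: transport_def congruence_refl[OF r] ang_closed ract_closed)
next
  fix t t' p assume t: "(t, t') \<in> transport r" and p: "p \<in> carrier T"
  \<comment> \<open>The point \<open>x \<lhd> p\<close> takes the place of \<open>x\<close> in the
    test.\<close>
  then show "(p \<cdot>\<^bsub>T\<^esub> t, p \<cdot>\<^bsub>T\<^esub> t') \<in> transport r"
    by (simp add: transport_def T.sg_closed ract_mult ract_closed)
  \<comment> \<open>Once \<open>p\<close> is a bracket, it splits off from the tested element as the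
    right factor \<open>ang v y\<close>.\<close>
  obtain u v where uv: "u \<in> X" "v \<in> X" "p = sqb u v"
    using p by (rule sqb_cases)
  have "(ang (x \<lhd> t) u \<cdot>\<^bsub>S\<^esub> ang v y, ang (x \<lhd> t') u \<cdot>\<^bsub>S\<^esub> ang v y) \<in> r"
    if "x \<in> X" "y \<in> X" for x y
    using that t uv
    by (auto simp: transport_def intro!: congruence_mult[OF r] congruence_refl[OF r] ang_closed)
  with t p uv show "(t \<cdot>\<^bsub>T\<^esub> p, t' \<cdot>\<^bsub>T\<^esub> p) \<in> transport r"
    by (simp add: transport_def T.sg_closed ract_mult ract_closed ang_ract_sqb)
next
  fix t t' t'' assume "(t, t') \<in> transport r" "(t', t'') \<in> transport r"
  then show "(t, t'') \<in> transport r"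
    unfolding transport_def by (blast intro: congruence_trans[OF r])
qed (auto simp: transport_def intro: congruence_sym[OF r])

end

section \<open>Recovering a congruence from two-sided multiples\<close>

lemma (in inverse_semigroup) congruence_iff_multiples:
  assumes dir: "directed_idempotents S" and r: "r \<in> congruences S"
    and s: "s \<in> carrier S" "s' \<in> carrier S"
  shows "(s, s') \<in> r \<longleftrightarrow>
    (\<forall>a\<in>carrier S. \<forall>b\<in>carrier S. (a \<cdot> s \<cdot> b, a \<cdot> s' \<cdot> b) \<in> r)"
proof
  assume "(s, s') \<in> r"
  then show "\<forall>a\<in>carrier S. \<forall>b\<in>carrier S. (a \<cdot> s \<cdot> b, a \<cdot> s' \<cdot> b) \<in> r"
    by (auto intro!: congruence_mult[OF r] congruence_refl[OF r])
next
  assume *: "\<forall>a\<in>carrier S. \<forall>b\<in>carrier S. (a \<cdot> s \<cdot> b, a \<cdot> s' \<cdot> b) \<in> r"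
  obtain f where f: "f \<in> idempotents S" "\<And>u. u \<in> {s, s'} \<Longrightarrow> f \<cdot> u = u"
    "\<And>u. u \<in> {s, s'} \<Longrightarrow> u \<cdot> f = u"
    by (rule common_local_identity[OF dir, of "{s, s'}"]) (use s in auto)
  have "(f \<cdot> s \<cdot> f, f \<cdot> s' \<cdot> f) \<in> r"
    using * idempotent_closed[OF f(1)] by blast
  then show "(s, s') \<in> r"
    by (simp add: f(2,3))
qed

context morita_context
begin

interpretation swap: morita_context T S X "\<lambda>t x. x \<lhd> sg_inv T t" "\<lambda>x s. sg_inv S s \<rhd> x" sqb ang
  by (rule morita_context_swap)

lemma transport_swap_transport:
  assumes dir: "directed_idempotents S" and r: "r \<in> congruences S"
  shows "swap.transport (transport r) = r"
proof -
  \<comment> \<open>The inverse in the swapped action cancels the one that arises when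
    \<open>s\<close> leaves the second argument of \<open>ang\<close>.\<close>
  have ang4: "ang (u \<lhd> sqb (sg_inv S s \<rhd> x) y) v = ang u x \<cdot>\<^bsub>S\<^esub> s \<cdot>\<^bsub>S\<^esub> ang y v"
    if "s \<in> carrier S" "u \<in> X" "x \<in> X" "y \<in> X" "v \<in> X" for s u x y v
    using that by (simp add: ang_ract_sqb lact_closed ang_lact_right S.sg_inv_closed S.sg_inv_inv)
  have "(s, s') \<in> swap.transport (transport r) \<longleftrightarrow> (s, s') \<in> r"
    if s: "s \<in> carrier S" "s' \<in> carrier S" for s s'
  proof -
    have "(s, s') \<in> swap.transport (transport r) \<longleftrightarrow>
        (\<forall>x\<in>X. \<forall>y\<in>X. \<forall>u\<in>X. \<forall>v\<in>X.
          (ang u x \<cdot>\<^bsub>S\<^esub> s \<cdot>\<^bsub>S\<^esub> ang y v, ang u x \<cdot>\<^bsub>S\<^esub> s' \<cdot>\<^bsub>S\<^esub> ang y v) \<in> r)"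
      using s by (simp add: swap.transport_def transport_def ang4 sqb_closed lact_closed
          S.sg_inv_closed)
    \<comment> \<open>Since \<open>ang\<close> is onto, the outer brackets run through all of
      \<open>carrier S\<close>.\<close>
    also have "\<dots> \<longleftrightarrow>
        (\<forall>a\<in>carrier S. \<forall>b\<in>carrier S. (a \<cdot>\<^bsub>S\<^esub> s \<cdot>\<^bsub>S\<^esub> b, a \<cdot>\<^bsub>S\<^esub> s' \<cdot>\<^bsub>S\<^esub> b) \<in> r)"
      by (auto simp flip: ang_onto)
    finally show ?thesis
      using S.congruence_iff_multiples[OF dir r s] by simp
  qed
  moreover have "swap.transport (transport r) \<subseteq> carrier S \<times> carrier S"
    by (auto simp: swap.transport_def)
  moreover have "r \<subseteq> carrier S \<times> carrier S"
    using congruence_field[OF r] by auto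
  ultimately show ?thesis
    by blast
qed

text \<open>This is \<open>transport_swap_transport\<close> for the swapped context. Swapping twice
  puts a double inverse into the right action; \<open>transport\<close> tests it only on
  \<open>carrier T\<close>, where double inversion is the identity.\<close>

lemma transport_transport_swap:
  assumes dir: "directed_idempotents T" and r: "r \<in> congruences T"
  shows "transport (swap.transport r) = r"
proof -
  have "morita_context.transport T X (\<lambda>x t. x \<lhd> sg_inv T (sg_inv T t)) ang = transport"
    unfolding transport_def morita_context.transport_def[OF swap.morita_context_swap]
    by (simp add: T.sg_inv_inv cong: conj_cong)
  then show ?thesis
    using morita_context.transport_swap_transport[OF morita_context_swap dir r] by simp
qed

lemma cong_lattices_isomorphic:
  assumes "directed_idempotents S" "directed_idempotents T"
  shows "lattices_isomorphic (cong_lattice S) (cong_lattice T)"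
proof (rule lattices_isomorphicI[where f = transport and g = swap.transport])
  show "lattice (cong_lattice S)" "lattice (cong_lattice T)"
    using S.cong_lattice_complete T.cong_lattice_complete by simp_all
qed (use assms in \<open>auto simp: cong_lattice_def transport_congruence swap.transport_congruence
    transport_swap_transport transport_transport_swap
    dest: subsetD[OF transport_mono] subsetD[OF swap.transport_mono]\<close>)

end

theorem corollary5p10:
  fixes S :: "('a, 'm) semigrp_scheme" and T :: "('b, 'n) semigrp_scheme"
  assumes "inverse_semigroup S" and "inverse_semigroup T"
    and "strongly_morita_equivalent TYPE('x) S T"
    and "directed_idempotents S" and "directed_idempotents T"
  shows "lattices_isomorphic (cong_lattice S) (cong_lattice T)"
proof -
  obtain X :: "'x set" and lact ract ang sqb where "morita_context S T X lact ract ang sqb"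
    using assms(3) unfolding strongly_morita_equivalent_def by blast
  then show ?thesis
    using assms(4,5) by (rule morita_context.cong_lattices_isomorphic)
qed

end
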